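(* Let $z\ge 2$ be an integer and let $G_z$ be the mixed graph obtained from the Kautz digraph $\mathrm{Ka}(z+1,2)$ (viewed as a mixed graph, each pair of opposite arcs being replaced by an edge) by the arc swap on the ordered vertices $(u,u',v,v')=(01,03,12,32)$; that is, the arcs $01\to 12$ and $03\to 32$ are removed and the arcs $01\to 32$ and $03\to 12$ are added. Then $G_z$ is a $(1,z,2)$-mixed radial Moore graph, and it is the closest graph to a mixed Moore graph according to the status norm: for every $(1,z,2)$-mixed radial Moore graph $G$, either $N_p(G_z)=N_p(G)$ for every positive integer $p$, or there is a positive integer $l$ such that $N_p(G_z)=N_p(G)$ for $p=1,\dots,l-1$ and $N_l(G_z)<N_l(G)$.
   Context: A mixed graph $G=(V,E,A)$ has a finite vertex set $V$, a set $E$ of undirected edges and a set $A$ of directed edges (arcs). The undirected degree of a vertex is the number of edges incident to it; its out-degree (in-degree) is the number of arcs leaving (entering) it. $G$ is totally $(r,z)$-regular if every vertex has undirected degree $r$, in-degree $z$ and out-degree $z$. A walk of length $\ell$ from $u$ to $v$ is a sequence $u=u_0,\dots,u_\ell=v$ such that for each $i$ the pair $u_{i-1}u_i$ is an edge, or an arc from $u_{i-1}$ to $u_i$. The distance $d(u,v)$ is the length of a shortest path from $u$ to $v$. The out-eccentricity of $u$ is the maximum distance from $u$ to any vertex; the radius is the minimum and the diameter the maximum of the out-eccentricities. The status of $v$ is $s(v)=\sum_{u\in V}d(v,u)$, and the status vector $\mathbf{s}(G)$ is the vector of the statuses of all vertices. An $(r,z,k)$-mixed radial Moore graph is a totally $(r,z)$-regular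 mixed graph of radius $k$, diameter $k+1$ and order $M(r,z,k)$, the mixed Moore bound; for $k=2$, $M(r,z,2)=(r+z)^2+z+1$. Let $\mathbf{s}_{r,z,k}$ be the vector of dimension $M(r,z,k)$ all of whose components equal the status of a vertex in a mixed Moore graph with parameters $(r,z,k)$; for $k=2$ this common value is $(r+z)+2\big((r+z)^2-r\big)$. For an $(r,z,k)$-mixed radial Moore graph $G$ and a positive integer $p$, $N_p(G)=\|\mathbf{s}(G)-\mathbf{s}_{r,z,k}\|_p$ (the $\ell_p$ norm). $G_1$ is closer than $G_2$ to being a mixed Moore graph if there is a positive integer $l$ with $N_p(G_1)=N_p(G_2)$ for $p=1,\dots,l-1$ and $N_l(G_1)<N_l(G_2)$; this induces a total order on the mixed radial Moore graphs with given parameters modulo having the same status vector. The vertices of the Kautz digraph $\mathrm{Ka}(d,2)$ are the words $ab$ of length $2$ on the alphabet $\{0,1,\dots,d\}$ with $a\ne b$; there is an arc from $ab$ to each vertex $bx$ with $x\neq b$. Replacing every pair of opposite arcs (between $ab$ and $ba$) by an edge yields a mixed graph with $r=1$ and $z=d-1$. Arc swap: for four (ordered) distinct vertices $(u,u',v,v')$ of a mixed graph with $uv,u'v'\in A$ and $uv',u'v\notin A\cup E$, the arc swap removes the arcs $uv,u'v'$ and adds the arcs $uv'$ and $u'v$. *)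

theory Defs
  imports Complex_Main "HOL-Library.Extended_Nat"
begin

text \<open>
  Edges are two-element sets and arcs are pairs of distinct vertices. Nothing else is excluded:
  a pair of opposite arcs, or an arc parallel to an edge, may occur.
\<close>

record 'a mgraph =
  verts :: "'a set"
  edges :: "'a set set"
  arcs :: "('a \<times> 'a) set"

locale mixed_graph =
  fixes G :: "'a mgraph"
  assumes finite_verts: "finite (verts G)"
    and edges_wf: "\<And>e. e \<in> edges G \<Longrightarrow> \<exists>u\<in>verts G. \<exists>v\<in>verts G. u \<noteq> v \<and> e = {u, v}"
    and arcs_wf: "\<And>u v. (u, v) \<in> arcs G \<Longrightarrow> u \<in> verts G \<and> v \<in> verts G \<and> u \<noteq> v"

definition undirected_degree :: "'a mgraph \<Rightarrow> 'a \<Rightarrow> nat" where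
  "undirected_degree G v = card {e \<in> edges G. v \<in> e}"

definition out_degree :: "'a mgraph \<Rightarrow> 'a \<Rightarrow> nat" where
  "out_degree G v = card {a \<in> arcs G. fst a = v}"

definition in_degree :: "'a mgraph \<Rightarrow> 'a \<Rightarrow> nat" where
  "in_degree G v = card {a \<in> arcs G. snd a = v}"

definition totally_regular :: "nat \<Rightarrow> nat \<Rightarrow> 'a mgraph \<Rightarrow> bool" where
  "totally_regular r z G \<longleftrightarrow>
     (\<forall>v\<in>verts G. undirected_degree G v = r \<and> in_degree G v = z \<and> out_degree G v = z)"

definition adjacent :: "'a mgraph \<Rightarrow> 'a \<Rightarrow> 'a \<Rightarrow> bool" where
  "adjacent G u v \<longleftrightarrow> {u, v} \<in> edges G \<or> (u, v) \<in> arcs G"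

text \<open>A walk is given by its list of vertices, so its length is one less than that of the list.\<close>

definition walk :: "'a mgraph \<Rightarrow> 'a \<Rightarrow> 'a list \<Rightarrow> 'a \<Rightarrow> bool" where
  "walk G u p v \<longleftrightarrow>
     p \<noteq> [] \<and> hd p = u \<and> last p = v \<and> set p \<subseteq> verts G \<and> successively (adjacent G) p"

definition path :: "'a mgraph \<Rightarrow> 'a \<Rightarrow> 'a list \<Rightarrow> 'a \<Rightarrow> bool" where
  "path G u p v \<longleftrightarrow> walk G u p v \<and> distinct p"

text \<open>The distance is \<open>\<infinity>\<close> if there is no path.\<close>

definition distance :: "'a mgraph \<Rightarrow> 'a \<Rightarrow> 'a \<Rightarrow> enat" where
  "distance G u v = (INF p\<in>{p. path G u p v}. enat (length p - 1))"

definition out_eccentricity :: "'a mgraph \<Rightarrow> 'a \<Rightarrow> enat" where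
  "out_eccentricity G u = (SUP v\<in>verts G. distance G u v)"

definition radius :: "'a mgraph \<Rightarrow> enat" where
  "radius G = (INF u\<in>verts G. out_eccentricity G u)"

definition diameter :: "'a mgraph \<Rightarrow> enat" where
  "diameter G = (SUP u\<in>verts G. out_eccentricity G u)"

definition status :: "'a mgraph \<Rightarrow> 'a \<Rightarrow> enat" where
  "status G v = (\<Sum>u\<in>verts G. distance G v u)"

text \<open>
  The numbers of vertices at depth \<open>i\<close> of the mixed Moore tree that are entered through an edge
  and through an arc, respectively. A vertex entered through an edge has one of its \<open>r\<close> edges
  used up; the root has none used up and is therefore counted in the second component.
\<close>

fun moore_level :: "nat \<Rightarrow> nat \<Rightarrow> nat \<Rightarrow> nat \<times> nat" where
  "moore_level r z 0 = (0, 1)"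
| "moore_level r z (Suc i) =
     (let (a, b) = moore_level r z i in ((r - 1) * a + r * b, z * (a + b)))"

definition moore_level_size :: "nat \<Rightarrow> nat \<Rightarrow> nat \<Rightarrow> nat" where
  "moore_level_size r z i = fst (moore_level r z i) + snd (moore_level r z i)"

definition mixed_moore_bound :: "nat \<Rightarrow> nat \<Rightarrow> nat \<Rightarrow> nat" where
  "mixed_moore_bound r z k = (\<Sum>i\<le>k. moore_level_size r z i)"

definition moore_status :: "nat \<Rightarrow> nat \<Rightarrow> nat \<Rightarrow> nat" where
  "moore_status r z k = (\<Sum>i\<le>k. i * moore_level_size r z i)"

lemma moore_level_size_2: "moore_level_size r z 2 + r = (r + z)\<^sup>2"
  by (cases r) (simp_all add: moore_level_size_def numeral_2_eq_2 algebra_simps)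

lemma mixed_moore_bound_2: "mixed_moore_bound r z 2 = (r + z)\<^sup>2 + z + 1"
  using moore_level_size_2[of r z]
  by (simp add: mixed_moore_bound_def numeral_2_eq_2 moore_level_size_def)

lemma moore_status_2: "moore_status r z 2 = (r + z) + 2 * ((r + z)\<^sup>2 - r)"
  using moore_level_size_2[of r z]
  by (simp add: moore_status_def numeral_2_eq_2 moore_level_size_def)

definition mixed_radial_moore_graph :: "nat \<Rightarrow> nat \<Rightarrow> nat \<Rightarrow> 'a mgraph \<Rightarrow> bool" where
  "mixed_radial_moore_graph r z k G \<longleftrightarrow>
     mixed_graph G \<and> totally_regular r z G \<and> radius G = enat k \<and> diameter G = enat (k + 1) \<and>
     card (verts G) = mixed_moore_bound r z k"

text \<open>
  Statuses are finite in a mixed radial Moore graph, so \<open>the_enat\<close> is harmless there.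
\<close>

definition status_norm :: "nat \<Rightarrow> nat \<Rightarrow> nat \<Rightarrow> nat \<Rightarrow> 'a mgraph \<Rightarrow> real" where
  "status_norm r z k p G =
     root p (\<Sum>v\<in>verts G. \<bar>real (the_enat (status G v)) - real (moore_status r z k)\<bar> ^ p)"

definition closer_to_moore :: "nat \<Rightarrow> nat \<Rightarrow> nat \<Rightarrow> 'a mgraph \<Rightarrow> 'b mgraph \<Rightarrow> bool" where
  "closer_to_moore r z k G H \<longleftrightarrow>
     (\<exists>l\<ge>1. (\<forall>p. 1 \<le> p \<and> p < l \<longrightarrow> status_norm r z k p G = status_norm r z k p H) \<and>
             status_norm r z k l G < status_norm r z k l H)"

definition mixed_of_digraph :: "'a set \<Rightarrow> ('a \<times> 'a) set \<Rightarrow> 'a mgraph" where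
  "mixed_of_digraph V D =
     \<lparr>verts = V,
      edges = {{u, v} | u v. (u, v) \<in> D \<and> (v, u) \<in> D},
      arcs = {(u, v). (u, v) \<in> D \<and> (v, u) \<notin> D}\<rparr>"

definition kautz_verts :: "nat \<Rightarrow> (nat \<times> nat) set" where
  "kautz_verts d = {(a, b). a \<le> d \<and> b \<le> d \<and> a \<noteq> b}"

definition kautz_arcs :: "nat \<Rightarrow> ((nat \<times> nat) \<times> (nat \<times> nat)) set" where
  "kautz_arcs d = {((a, b), (b', x)). (a, b) \<in> kautz_verts d \<and> (b', x) \<in> kautz_verts d \<and> b' = b}"

definition mixed_kautz :: "nat \<Rightarrow> (nat \<times> nat) mgraph" where
  "mixed_kautz d = mixed_of_digraph (kautz_verts d) (kautz_arcs d)"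

definition arc_swappable :: "'a mgraph \<Rightarrow> 'a \<Rightarrow> 'a \<Rightarrow> 'a \<Rightarrow> 'a \<Rightarrow> bool" where
  "arc_swappable G u u' v v' \<longleftrightarrow>
     distinct [u, u', v, v'] \<and> {u, u', v, v'} \<subseteq> verts G \<and>
     (u, v) \<in> arcs G \<and> (u', v') \<in> arcs G \<and>
     (u, v') \<notin> arcs G \<and> {u, v'} \<notin> edges G \<and> (u', v) \<notin> arcs G \<and> {u', v} \<notin> edges G"

text \<open>Only meaningful for \<open>arc_swappable G u u' v v'\<close>.\<close>

definition arc_swap :: "'a mgraph \<Rightarrow> 'a \<Rightarrow> 'a \<Rightarrow> 'a \<Rightarrow> 'a \<Rightarrow> 'a mgraph" where
  "arc_swap G u u' v v' = G\<lparr>arcs := (arcs G - {(u, v), (u', v')}) \<union> {(u, v'), (u', v)}\<rparr>"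

definition swapped_kautz :: "nat \<Rightarrow> (nat \<times> nat) mgraph" where
  "swapped_kautz z = arc_swap (mixed_kautz (z + 1)) (0, 1) (0, 3) (1, 2) (3, 2)"

lemma swapped_kautz_arc_swappable:
  assumes "z \<ge> 2"
  shows "arc_swappable (mixed_kautz (z + 1)) (0, 1) (0, 3) (1, 2) (3, 2)"
  using assms
  by (auto simp: arc_swappable_def mixed_kautz_def mixed_of_digraph_def kautz_arcs_def
      kautz_verts_def doubleton_eq_iff)

end

theory Submission imports Defs begin

text \<open>
  Let \<open>N = (z + 1) * (z + 2)\<close>, the mixed Moore bound for \<open>r = 1\<close> and diameter \<open>2\<close>. In a totally
  \<open>(1, z)\<close>-regular graph of order \<open>N\<close>, exactly \<open>(z + 1) + (z + 1)\<^sup>2 = N\<close> walks of length \<open>1\<close> or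
  \<open>2\<close> start at each vertex, and exactly \<open>N\<close> of them end at each vertex
  (\<open>sum_short_walks_out\<close>, \<open>sum_short_walks_in\<close>). One of those from \<open>u\<close> returns to \<open>u\<close>, back
  and forth along its edge. So if \<open>u\<close> has out-eccentricity at most \<open>2\<close>, then its \<open>N\<close> walks
  have distinct ends and fill all \<open>N\<close> vertices (\<open>short_walks_eq_1\<close>).

  Now suppose that \<open>u\<close> is the only vertex of out-eccentricity \<open>3\<close>, and that \<open>w\<close> is at distance
  \<open>3\<close> from it. Each of the other \<open>N - 1\<close> vertices starts exactly one short walk to \<open>w\<close>, and \<open>u\<close>
  starts none, so only \<open>N - 1\<close> short walks end at \<open>w\<close>, a contradiction. Hence a mixed radial Moore
  graph has at least two vertices of out-eccentricity \<open>3\<close> (\<open>another_far_vertex\<close>). The status of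
  such a vertex differs from the Moore status, and the difference is an integer, so
  \<open>N\<^sub>p(G) \<ge> 2 powr (1 / p)\<close> for every \<open>p\<close> (\<open>sum_status_deviation_ge_2\<close>).

  The swapped Kautz graph attains this bound for all \<open>p\<close> at once. The two heads \<open>12\<close> and
  \<open>32\<close> that are exchanged have the same out-neighbours \<open>2x\<close>, and the two tails \<open>01\<close> and \<open>03\<close> have
  the same in-neighbours \<open>y0\<close>, where an edge counts in both directions. Therefore the swap only spoils the distance from \<open>01\<close> to \<open>12\<close> and from \<open>03\<close> to \<open>32\<close>, which become \<open>3\<close>,
  and two statuses exceed the Moore status, each by \<open>1\<close>.
\<close>

section \<open>Distances up to two\<close>

lemma distance_le_length:
  assumes "path G u p v"
  shows "distance G u v \<le> enat (length p - 1)"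
  unfolding distance_def using assms by (intro INF_lower) simp

lemma distance_le_enatE:
  assumes "distance G u v \<le> enat n"
  obtains p where "path G u p v" "length p \<le> Suc n"
proof -
  have "distance G u v < enat (Suc n)"
    using assms by (rule le_less_trans) simp
  then obtain p where "path G u p v" "enat (length p - 1) < enat (Suc n)"
    unfolding distance_def INF_less_iff by blast
  then show thesis
    using that by auto
qed

context mixed_graph
begin

lemma adjacent_wf:
  assumes "adjacent G u v"
  shows "u \<in> verts G" "v \<in> verts G" "u \<noteq> v"
  using assms edges_wf[of "{u, v}"] arcs_wf[of u v]
  by (auto simp: adjacent_def doubleton_eq_iff)

lemma distance_le_0_iff:
  assumes "u \<in> verts G"
  shows "distance G u v \<le> 0 \<longleftrightarrow> u = v"
proof
  assume "distance G u v \<le> 0"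
  then obtain p where "path G u p v" "length p \<le> 1"
    by (metis distance_le_enatE One_nat_def zero_enat_def)
  then show "u = v"
    by (cases p) (auto simp: path_def walk_def)
next
  assume "u = v"
  with assms have "path G u [u] v"
    by (simp add: path_def walk_def)
  from distance_le_length[OF this] show "distance G u v \<le> 0"
    by (simp add: zero_enat_def)
qed

lemma distance_le_1_iff:
  assumes "u \<in> verts G"
  shows "distance G u v \<le> 1 \<longleftrightarrow> u = v \<or> adjacent G u v"
proof
  assume "distance G u v \<le> 1"
  then obtain p where p: "path G u p v" "length p \<le> 2"
    by (metis distance_le_enatE Suc_1 one_enat_def)
  then consider "p = [u]" "u = v" | "p = [u, v]"
    by (cases p; cases "tl p") (auto simp: path_def walk_def)
  then show "u = v \<or> adjacent G u v"
    using p by cases (auto simp: path_def walk_def)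
next
  assume "u = v \<or> adjacent G u v"
  then show "distance G u v \<le> 1"
  proof (cases "u = v")
    case True
    with assms show ?thesis
      using distance_le_0_iff[of u v] by simp
  next
    case False
    with \<open>u = v \<or> adjacent G u v\<close> have "path G u [u, v] v"
      using adjacent_wf[of u v] by (auto simp: path_def walk_def)
    from distance_le_length[OF this] show ?thesis
      by (simp add: one_enat_def)
  qed
qed

lemma distance_le_2_iff:
  assumes "u \<in> verts G"
  shows "distance G u v \<le> 2 \<longleftrightarrow>
    u = v \<or> adjacent G u v \<or> (\<exists>x. adjacent G u x \<and> adjacent G x v)"
    (is "_ \<longleftrightarrow> ?R")
proof
  assume "distance G u v \<le> 2"
  then obtain p where p: "path G u p v" "length p \<le> 3"
    by (metis distance_le_enatE eval_nat_numeral(3) numeral_eq_enat)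
  then consider "u = v" | "p = [u, v]" | x where "p = [u, x, v]"
    by (cases p; cases "tl p"; cases "tl (tl p)") (auto simp: path_def walk_def)
  then show ?R
    using p by cases (auto simp: path_def walk_def)
next
  assume R: ?R
  show "distance G u v \<le> 2"
  proof (cases "u = v \<or> adjacent G u v")
    case True
    then have "distance G u v \<le> 1"
      using distance_le_1_iff[OF assms] by simp
    also have "(1 :: enat) \<le> 2"
      by (simp add: numeral_eq_enat one_enat_def)
    finally show ?thesis .
  next
    case False
    with R obtain x where x: "adjacent G u x" "adjacent G x v"
      by blast
    with False have "path G u [u, x, v] v"
      using adjacent_wf[OF x(1)] adjacent_wf[OF x(2)] by (auto simp: path_def walk_def)
    from distance_le_length[OF this] show ?thesis
      by (simp add: numeral_eq_enat eval_nat_numeral)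
  qed
qed

end

section \<open>Counting short walks\<close>

text \<open>
  An arc may be parallel to an edge, and the degrees count both. A walk is therefore counted once
  for each choice of the edges and arcs that it uses. This is the adjacency matrix \<open>A\<close> of the graph.
\<close>

definition multiplicity :: "'a mgraph \<Rightarrow> 'a \<Rightarrow> 'a \<Rightarrow> nat" where
  "multiplicity G u v = of_bool ({u, v} \<in> edges G) + of_bool ((u, v) \<in> arcs G)"

text \<open>The entries of \<open>A + A\<^sup>2\<close>. The walk along an edge and back contributes to the diagonal.\<close>

definition short_walks :: "'a mgraph \<Rightarrow> 'a \<Rightarrow> 'a \<Rightarrow> nat" where
  "short_walks G u v =
     multiplicity G u v + (\<Sum>x\<in>verts G. multiplicity G u x * multiplicity G x v)"

lemma multiplicity_pos_iff: "0 < multiplicity G u v \<longleftrightarrow> adjacent G u v"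
  by (auto simp: multiplicity_def adjacent_def)

context mixed_graph
begin

lemma card_edge_neighbours: "card {v \<in> verts G. {u, v} \<in> edges G} = undirected_degree G u"
proof -
  have "bij_betw (\<lambda>v. {u, v}) {v \<in> verts G. {u, v} \<in> edges G} {e \<in> edges G. u \<in> e}"
    unfolding bij_betw_def
  proof
    show "inj_on (\<lambda>v. {u, v}) {v \<in> verts G. {u, v} \<in> edges G}"
      by (auto simp: inj_on_def doubleton_eq_iff)
    show "(\<lambda>v. {u, v}) ` {v \<in> verts G. {u, v} \<in> edges G} = {e \<in> edges G. u \<in> e}"
    proof (intro equalityI subsetI)
      fix e assume "e \<in> {e \<in> edges G. u \<in> e}"
      then show "e \<in> (\<lambda>v. {u, v}) ` {v \<in> verts G. {u, v} \<in> edges G}"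
        using edges_wf[of e] by (auto simp: insert_commute)
    qed auto
  qed
  then show ?thesis
    unfolding undirected_degree_def by (rule bij_betw_same_card)
qed

lemma card_out_arcs: "card {v \<in> verts G. (u, v) \<in> arcs G} = out_degree G u"
proof -
  have "bij_betw (Pair u) {v \<in> verts G. (u, v) \<in> arcs G} {a \<in> arcs G. fst a = u}"
    using arcs_wf by (auto simp: bij_betw_def inj_on_def)
  then show ?thesis
    unfolding out_degree_def by (rule bij_betw_same_card)
qed

lemma card_in_arcs: "card {u \<in> verts G. (u, v) \<in> arcs G} = in_degree G v"
proof -
  have "bij_betw (\<lambda>u. (u, v)) {u \<in> verts G. (u, v) \<in> arcs G} {a \<in> arcs G. snd a = v}"
    using arcs_wf by (auto simp: bij_betw_def inj_on_def)
  then show ?thesis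
    unfolding in_degree_def by (rule bij_betw_same_card)
qed

lemma sum_multiplicity_out:
  "(\<Sum>v\<in>verts G. multiplicity G u v) = undirected_degree G u + out_degree G u"
  using finite_verts
  by (simp add: multiplicity_def sum.distrib Int_def
      flip: card_edge_neighbours card_out_arcs)

lemma sum_multiplicity_in:
  "(\<Sum>u\<in>verts G. multiplicity G u v) = undirected_degree G v + in_degree G v"
  using finite_verts
  by (simp add: multiplicity_def sum.distrib Int_def insert_commute
      flip: card_edge_neighbours card_in_arcs)

lemma short_walks_pos_iff:
  "0 < short_walks G u v \<longleftrightarrow> adjacent G u v \<or> (\<exists>x. adjacent G u x \<and> adjacent G x v)"
proof -
  have "0 < short_walks G u v \<longleftrightarrow>
      adjacent G u v \<or> (\<exists>x\<in>verts G. adjacent G u x \<and> adjacent G x v)"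
    unfolding multiplicity_pos_iff[symmetric]
    using finite_verts by (auto simp: short_walks_def simp flip: neq0_conv)
  then show ?thesis
    using adjacent_wf by blast
qed

end

locale moore_order_graph = mixed_graph G for G :: "'a mgraph" +
  fixes z :: nat
  assumes regular: "totally_regular 1 z G"
    and order: "card (verts G) = (z + 1) * (z + 2)"
begin

lemma sum_short_walks_out:
  assumes "u \<in> verts G"
  shows "(\<Sum>v\<in>verts G. short_walks G u v) = card (verts G)"
proof -
  have out: "(\<Sum>v\<in>verts G. multiplicity G x v) = z + 1" if "x \<in> verts G" for x
    using regular that by (simp add: sum_multiplicity_out totally_regular_def)
  have "(\<Sum>v\<in>verts G. \<Sum>x\<in>verts G. multiplicity G u x * multiplicity G x v) =
      (\<Sum>x\<in>verts G. multiplicity G u x * (\<Sum>v\<in>verts G. multiplicity G x v))"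
    by (subst sum.swap) (simp add: sum_distrib_left)
  also have "\<dots> = (\<Sum>x\<in>verts G. multiplicity G u x * (z + 1))"
    using out by (intro sum.cong) auto
  also have "\<dots> = (z + 1) * (z + 1)"
    using out[OF assms] by (simp only: sum_distrib_right[symmetric])
  finally show ?thesis
    using out[OF assms] by (simp add: short_walks_def sum.distrib order algebra_simps)
qed

lemma sum_short_walks_in:
  assumes "v \<in> verts G"
  shows "(\<Sum>u\<in>verts G. short_walks G u v) = card (verts G)"
proof -
  have "in": "(\<Sum>u\<in>verts G. multiplicity G u x) = z + 1" if "x \<in> verts G" for x
    using regular that by (simp add: sum_multiplicity_in totally_regular_def)
  have "(\<Sum>u\<in>verts G. \<Sum>x\<in>verts G. multiplicity G u x * multiplicity G x v) =
      (\<Sum>x\<in>verts G. (\<Sum>u\<in>verts G. multiplicity G u x) * multiplicity G x v)"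
    by (subst sum.swap) (simp add: sum_distrib_right)
  also have "\<dots> = (\<Sum>x\<in>verts G. (z + 1) * multiplicity G x v)"
    using "in" by (intro sum.cong) auto
  also have "\<dots> = (z + 1) * (z + 1)"
    using "in"[OF assms] by (simp only: sum_distrib_left[symmetric])
  finally show ?thesis
    using "in"[OF assms] by (simp add: short_walks_def sum.distrib order algebra_simps)
qed

text \<open>
  On the diagonal, the distance is \<open>0\<close> and the short walk is supplied by the edge at \<open>u\<close>.
\<close>

lemma short_walks_pos_iff_distance:
  assumes "u \<in> verts G"
  shows "0 < short_walks G u v \<longleftrightarrow> distance G u v \<le> 2"
proof -
  have "card {x \<in> verts G. {u, x} \<in> edges G} = 1"
    using assms regular by (simp add: card_edge_neighbours totally_regular_def)
  then obtain x where "{u, x} \<in> edges G"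
    by (metis (mono_tags, lifting) card_1_singletonE mem_Collect_eq singletonI)
  then have "adjacent G u x" "adjacent G x u"
    by (simp_all add: adjacent_def insert_commute)
  then show ?thesis
    using assms by (auto simp: short_walks_pos_iff distance_le_2_iff)
qed

text \<open>
  The \<open>N\<close> short walks from \<open>u\<close> reach each of the \<open>N\<close> vertices, so none is reached twice.
\<close>

lemma short_walks_eq_1:
  assumes "u \<in> verts G" "\<forall>v\<in>verts G. distance G u v \<le> 2" "v \<in> verts G"
  shows "short_walks G u v = 1"
proof -
  have pos: "1 \<le> short_walks G u w" if "w \<in> verts G" for w
    using assms that short_walks_pos_iff_distance[of u w] by (simp add: Suc_le_eq)
  have "(\<Sum>w\<in>verts G. short_walks G u w - 1) = (\<Sum>w\<in>verts G. short_walks G u w) - (\<Sum>w\<in>verts G. 1)"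
    using pos by (intro sum_subtractf_nat) auto
  also have "\<dots> = 0"
    using sum_short_walks_out[OF assms(1)] by simp
  finally have "short_walks G u v - 1 = 0"
    using finite_verts assms(3) by simp
  with pos[OF assms(3)] show ?thesis
    by simp
qed

text \<open>
  If \<open>u\<close> were the only such vertex, the column of \<open>w\<close> in \<open>A + A\<^sup>2\<close> would consist of a \<open>0\<close> in row
  \<open>u\<close> and of ones elsewhere, whereas its sum is \<open>N\<close>.
\<close>

lemma another_far_vertex:
  assumes "u \<in> verts G" "w \<in> verts G" "\<not> distance G u w \<le> 2"
  obtains u' w' where "u' \<in> verts G" "u' \<noteq> u" "w' \<in> verts G" "\<not> distance G u' w' \<le> 2"
proof (rule ccontr)
  assume "\<not> thesis"
  with that have "short_walks G u' w = 1" if "u' \<in> verts G - {u}" for u'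
    using that assms(2) by (intro short_walks_eq_1) blast+
  moreover have "short_walks G u w = 0"
    using short_walks_pos_iff_distance[OF assms(1), of w] assms(3) by simp
  ultimately have "(\<Sum>u'\<in>verts G. short_walks G u' w) = card (verts G - {u})"
    using finite_verts assms(1) by (simp add: sum.remove)
  also have "\<dots> < card (verts G)"
    using finite_verts assms(1) by (rule card_Diff1_less)
  finally show False
    using sum_short_walks_in[OF assms(2)] by simp
qed

section \<open>Status excess\<close>

lemma card_out_neighbours_le:
  assumes "v \<in> verts G"
  shows "card {w \<in> verts G. adjacent G v w} \<le> z + 1"
proof -
  have "{w \<in> verts G. adjacent G v w} =
      {w \<in> verts G. {v, w} \<in> edges G} \<union> {w \<in> verts G. (v, w) \<in> arcs G}"
    by (auto simp: adjacent_def)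
  then have "card {w \<in> verts G. adjacent G v w} \<le> undirected_degree G v + out_degree G v"
    using card_Un_le[of "{w \<in> verts G. {v, w} \<in> edges G}" "{w \<in> verts G. (v, w) \<in> arcs G}"]
    by (simp only: card_edge_neighbours card_out_arcs)
  with assms regular show ?thesis
    by (simp add: totally_regular_def)
qed

lemma card_out_neighbours_eq:
  assumes "v \<in> verts G" "\<And>w. (v, w) \<in> arcs G \<Longrightarrow> {v, w} \<notin> edges G"
  shows "card {w \<in> verts G. adjacent G v w} = z + 1"
proof -
  have "{w \<in> verts G. adjacent G v w} =
      {w \<in> verts G. {v, w} \<in> edges G} \<union> {w \<in> verts G. (v, w) \<in> arcs G}"
    by (auto simp: adjacent_def)
  then have "card {w \<in> verts G. adjacent G v w} = undirected_degree G v + out_degree G v"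
    using finite_verts assms(2)
    by (simp add: card_edge_neighbours[symmetric] card_out_arcs[symmetric])
      (subst card_Un_disjoint; auto)
  with assms(1) regular show ?thesis
    by (simp add: totally_regular_def)
qed

text \<open>
  For \<open>w \<noteq> v\<close>, counting \<open>1\<close> more for an out-neighbour turns each distance \<open>1\<close> into \<open>2\<close>, so the
  corrected distance is \<open>2\<close>, or \<open>3\<close> if \<open>w\<close> is far. The summand \<open>2\<close> on the left makes up for \<open>v\<close>
  itself.
\<close>

lemma status_plus_out_neighbours:
  assumes "v \<in> verts G" "\<forall>w\<in>verts G. distance G v w \<le> 3"
  shows "the_enat (status G v) + card {w \<in> verts G. adjacent G v w} + 2 =
    2 * card (verts G) + card {w \<in> verts G. \<not> distance G v w \<le> 2}"
proof -
  define d where "d w = the_enat (distance G v w)" for w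
  have d: "distance G v w = enat (d w)" "d w \<le> 3" if w: "w \<in> verts G" for w
    using assms(2) w unfolding d_def
    by (cases "distance G v w"; force simp: numeral_eq_enat)+
  have "status G v = (\<Sum>w\<in>verts G. enat (d w))"
    using d by (simp add: status_def)
  also have "\<dots> = enat (\<Sum>w\<in>verts G. d w)"
    by (simp flip: of_nat_eq_enat)
  finally have status: "the_enat (status G v) = (\<Sum>w\<in>verts G. d w)"
    by simp
  \<comment> \<open>Both sides are \<open>2\<close> if \<open>w = v\<close>, since a vertex is not adjacent to itself.\<close>
  have "d w + of_bool (adjacent G v w) + 2 * of_bool (w = v) =
      2 + of_bool (\<not> distance G v w \<le> 2)" if w: "w \<in> verts G" for w
    using d[OF w] distance_le_0_iff[OF assms(1), of w] distance_le_1_iff[OF assms(1), of w]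
      adjacent_wf(3)[of v w]
    by (auto simp: numeral_eq_enat one_enat_def zero_enat_def)
  then have "(\<Sum>w\<in>verts G. d w + of_bool (adjacent G v w) + 2 * of_bool (w = v)) =
      (\<Sum>w\<in>verts G. 2 + of_bool (\<not> distance G v w \<le> 2))"
    by simp
  moreover have "(\<Sum>w\<in>verts G. of_bool (w = v)) = (1 :: nat)"
    using finite_verts assms(1) by (simp add: Int_insert_right)
  ultimately show ?thesis
    using finite_verts unfolding status
    by (simp add: sum.distrib sum_Suc Int_def flip: sum_distrib_left)
qed

lemma moore_status_order: "moore_status 1 z 2 + (z + 1) + 2 = 2 * card (verts G)"
  unfolding moore_status_2 order by (simp add: power2_eq_square)

text \<open>
  Arcs parallel to edges lower the number of out-neighbours, which only increases the status
  further above the Moore status.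
\<close>

lemma status_ne_moore:
  assumes "v \<in> verts G" "\<forall>w\<in>verts G. distance G v w \<le> 3"
    and "w \<in> verts G" "\<not> distance G v w \<le> 2"
  shows "the_enat (status G v) \<noteq> moore_status 1 z 2"
proof -
  have "0 < card {w \<in> verts G. \<not> distance G v w \<le> 2}"
    using finite_verts assms(3,4) by (auto simp: card_gt_0_iff)
  then show ?thesis
    using status_plus_out_neighbours[OF assms(1,2)] card_out_neighbours_le[OF assms(1)]
      moore_status_order by linarith
qed

lemma status_eq_moore_plus_far:
  assumes "v \<in> verts G" "\<forall>w\<in>verts G. distance G v w \<le> 3"
    and "\<And>w. (v, w) \<in> arcs G \<Longrightarrow> {v, w} \<notin> edges G"
  shows "the_enat (status G v) =
    moore_status 1 z 2 + card {w \<in> verts G. \<not> distance G v w \<le> 2}"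
  using status_plus_out_neighbours[OF assms(1,2)] card_out_neighbours_eq[OF assms(1,3)]
    moore_status_order by linarith

lemma out_eccentricity_ge_2:
  assumes "v \<in> verts G" "1 \<le> z"
  shows "2 \<le> out_eccentricity G v"
proof (rule ccontr)
  assume "\<not> 2 \<le> out_eccentricity G v"
  then have ecc: "out_eccentricity G v \<le> 1"
    by (cases "out_eccentricity G v") (auto simp: numeral_eq_enat one_enat_def)
  have "distance G v w \<le> 1" if "w \<in> verts G" for w
    using that ecc unfolding out_eccentricity_def by (meson SUP_upper order_trans)
  then have "verts G \<subseteq> insert v {w \<in> verts G. adjacent G v w}"
    using distance_le_1_iff[OF assms(1)] by auto
  then have "card (verts G) \<le> card (insert v {w \<in> verts G. adjacent G v w})"
    using finite_verts by (intro card_mono) auto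
  also have "\<dots> \<le> Suc (z + 1)"
    using card_out_neighbours_le[OF assms(1)] finite_verts
    by (simp add: card_insert_if)
  finally have "(z + 1) * (z + 2) \<le> z + 2"
    by (simp add: order)
  with assms(2) show False
    by simp
qed

lemma diameter_3_iff:
  "diameter G = 3 \<longleftrightarrow>
    (\<forall>u\<in>verts G. \<forall>w\<in>verts G. distance G u w \<le> 3) \<and>
    (\<exists>u\<in>verts G. \<exists>w\<in>verts G. \<not> distance G u w \<le> 2)"
proof -
  have le: "diameter G \<le> k \<longleftrightarrow> (\<forall>u\<in>verts G. \<forall>w\<in>verts G. distance G u w \<le> k)" for k
    by (simp add: diameter_def out_eccentricity_def SUP_le_iff)
  have "diameter G = 3 \<longleftrightarrow> diameter G \<le> 3 \<and> \<not> diameter G \<le> 2"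
    by (cases "diameter G") (auto simp: numeral_eq_enat)
  then show ?thesis
    by (auto simp: le)
qed

text \<open>Two vertices of out-eccentricity \<open>3\<close> each contribute a \<open>p\<close>-th power of a positive integer.\<close>

lemma sum_status_deviation_ge_2:
  assumes "diameter G = 3"
  shows "2 \<le> (\<Sum>v\<in>verts G.
    \<bar>real (the_enat (status G v)) - real (moore_status 1 z 2)\<bar> ^ p)"
    (is "_ \<le> (\<Sum>v\<in>verts G. ?f v)")
proof -
  obtain u w where u: "u \<in> verts G" "w \<in> verts G" "\<not> distance G u w \<le> 2"
    using assms by (auto simp: diameter_3_iff)
  then obtain u' w' where u': "u' \<in> verts G" "u' \<noteq> u" "w' \<in> verts G" "\<not> distance G u' w' \<le> 2"
    by (rule another_far_vertex)
  have ge_1: "1 \<le> ?f v" if "v \<in> verts G" "w \<in> verts G" "\<not> distance G v w \<le> 2" for v w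
  proof -
    have "the_enat (status G v) \<noteq> moore_status 1 z 2"
      using that assms by (intro status_ne_moore) (auto simp: diameter_3_iff)
    then show ?thesis
      by (intro one_le_power) linarith
  qed
  have "2 \<le> ?f u + ?f u'"
    using ge_1[OF u] ge_1[OF u'(1,3,4)] by linarith
  also have "\<dots> = (\<Sum>v\<in>{u, u'}. ?f v)"
    using u'(2) by simp
  also have "\<dots> \<le> (\<Sum>v\<in>verts G. ?f v)"
    using finite_verts u(1) u'(1) by (intro sum_mono2) auto
  finally show ?thesis .
qed

end

lemma mixed_radial_moore_graph_iff:
  "mixed_radial_moore_graph 1 z 2 G \<longleftrightarrow>
    moore_order_graph G z \<and> radius G = 2 \<and> diameter G = 3"
  by (auto simp: mixed_radial_moore_graph_def moore_order_graph_def moore_order_graph_axioms_def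
      mixed_moore_bound_2 power2_eq_square numeral_eq_enat)

section \<open>Swapping arcs\<close>

lemma adjacent_mixed_of_digraph: "adjacent (mixed_of_digraph V D) u v \<longleftrightarrow> (u, v) \<in> D"
  by (auto simp: adjacent_def mixed_of_digraph_def doubleton_eq_iff)

context
  fixes G :: "'a mgraph" and u u' v v' :: 'a
  assumes swappable: "arc_swappable G u u' v v'"
begin

lemma adjacent_arc_swap:
  assumes "\<And>x y. (x, y) \<in> arcs G \<Longrightarrow> {x, y} \<notin> edges G"
  shows "adjacent (arc_swap G u u' v v') x y \<longleftrightarrow>
    adjacent G x y \<and> (x, y) \<noteq> (u, v) \<and> (x, y) \<noteq> (u', v') \<or> (x, y) = (u, v') \<or> (x, y) = (u', v)"
  using swappable assms[of u v] assms[of u' v']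
  by (auto simp: adjacent_def arc_swap_def arc_swappable_def)

lemma arc_swap_no_parallel:
  assumes "\<And>x y. (x, y) \<in> arcs G \<Longrightarrow> {x, y} \<notin> edges G"
    and "(x, y) \<in> arcs (arc_swap G u u' v v')"
  shows "{x, y} \<notin> edges (arc_swap G u u' v v')"
  using swappable assms by (auto simp: arc_swap_def arc_swappable_def)

lemma mixed_graph_arc_swap:
  assumes "mixed_graph G"
  shows "mixed_graph (arc_swap G u u' v v')"
  using swappable assms by (auto simp: mixed_graph_def arc_swap_def arc_swappable_def)

text \<open>
  The swap pairs the removed and the added arcs in two ways: by their common tail, which preserves
  out-degrees, and by their common head, which preserves in-degrees.
\<close>

lemma bij_betw_arc_swap_fst:
  "bij_betw (\<lambda>a. if a = (u, v) then (u, v') else if a = (u', v') then (u', v) else a)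
    {a \<in> arcs G. fst a = x} {a \<in> arcs (arc_swap G u u' v v'). fst a = x}"
  using swappable
  by (auto simp: bij_betw_def inj_on_def image_iff arc_swap_def arc_swappable_def split: if_splits)

lemma bij_betw_arc_swap_snd:
  "bij_betw (\<lambda>a. if a = (u, v) then (u', v) else if a = (u', v') then (u, v') else a)
    {a \<in> arcs G. snd a = x} {a \<in> arcs (arc_swap G u u' v v'). snd a = x}"
  using swappable
  by (auto simp: bij_betw_def inj_on_def image_iff arc_swap_def arc_swappable_def split: if_splits)

lemma totally_regular_arc_swap:
  assumes "totally_regular r z G"
  shows "totally_regular r z (arc_swap G u u' v v')"
proof -
  have "out_degree (arc_swap G u u' v v') x = out_degree G x" for x
    using bij_betw_same_card[OF bij_betw_arc_swap_fst] by (simp add: out_degree_def)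
  moreover have "in_degree (arc_swap G u u' v v') x = in_degree G x" for x
    using bij_betw_same_card[OF bij_betw_arc_swap_snd] by (simp add: in_degree_def)
  moreover have "undirected_degree (arc_swap G u u' v v') x = undirected_degree G x" for x
    by (simp add: undirected_degree_def arc_swap_def)
  ultimately show ?thesis
    using assms by (simp add: totally_regular_def arc_swap_def)
qed

end

section \<open>The Kautz graph\<close>

lemma finite_kautz_verts: "finite (kautz_verts d)"
  by (rule finite_subset[of _ "{..d} \<times> {..d}"]) (auto simp: kautz_verts_def)

lemma card_kautz_verts: "card (kautz_verts d) = (d + 1) * d"
proof -
  have "kautz_verts d = (SIGMA a:{..d}. {..d} - {a})"
    by (auto simp: kautz_verts_def)
  then show ?thesis
    by simp
qed

lemma verts_mixed_kautz: "verts (mixed_kautz d) = kautz_verts d"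
  by (simp add: mixed_kautz_def mixed_of_digraph_def)

lemma adjacent_mixed_kautz:
  "adjacent (mixed_kautz d) u v \<longleftrightarrow> u \<in> kautz_verts d \<and> v \<in> kautz_verts d \<and> fst v = snd u"
  by (cases u; cases v) (auto simp: mixed_kautz_def adjacent_mixed_of_digraph kautz_arcs_def)

lemma edges_mixed_kautz:
  "edges (mixed_kautz d) = {{(a, b), (b, a)} | a b. (a, b) \<in> kautz_verts d}"
  (is "_ = ?E")
proof (intro equalityI subsetI)
  fix e assume "e \<in> edges (mixed_kautz d)"
  then obtain u v where "e = {u, v}" "(u, v) \<in> kautz_arcs d" "(v, u) \<in> kautz_arcs d"
    by (auto simp: mixed_kautz_def mixed_of_digraph_def)
  then show "e \<in> ?E"
    by (cases u; cases v) (auto simp: kautz_arcs_def)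
next
  fix e assume "e \<in> ?E"
  then obtain a b where "e = {(a, b), (b, a)}" "(a, b) \<in> kautz_verts d"
    by blast
  moreover from this have "((a, b), (b, a)) \<in> kautz_arcs d" "((b, a), (a, b)) \<in> kautz_arcs d"
    by (auto simp: kautz_arcs_def kautz_verts_def)
  ultimately show "e \<in> edges (mixed_kautz d)"
    by (auto simp: mixed_kautz_def mixed_of_digraph_def)
qed

lemma arcs_mixed_kautz:
  "arcs (mixed_kautz d) =
    {((a, b), (b, c)) | a b c. (a, b) \<in> kautz_verts d \<and> (b, c) \<in> kautz_verts d \<and> c \<noteq> a}"
  by (auto simp: mixed_kautz_def mixed_of_digraph_def kautz_arcs_def kautz_verts_def)

lemma mixed_kautz_no_parallel:
  "(u, v) \<in> arcs (mixed_kautz d) \<Longrightarrow> {u, v} \<notin> edges (mixed_kautz d)"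
  by (auto simp: mixed_kautz_def mixed_of_digraph_def doubleton_eq_iff)

lemma mixed_graph_mixed_kautz: "mixed_graph (mixed_kautz d)"
proof
  show "finite (verts (mixed_kautz d))"
    by (simp add: verts_mixed_kautz finite_kautz_verts)
  show "\<exists>u\<in>verts (mixed_kautz d). \<exists>v\<in>verts (mixed_kautz d). u \<noteq> v \<and> e = {u, v}"
    if e: "e \<in> edges (mixed_kautz d)" for e
  proof -
    obtain a b where "e = {(a, b), (b, a)}" "(a, b) \<in> kautz_verts d"
      using e by (auto simp: edges_mixed_kautz)
    then show ?thesis
      by (intro bexI[of _ "(a, b)"] bexI[of _ "(b, a)"])
        (auto simp: verts_mixed_kautz kautz_verts_def)
  qed
  show "u \<in> verts (mixed_kautz d) \<and> v \<in> verts (mixed_kautz d) \<and> u \<noteq> v"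
    if "(u, v) \<in> arcs (mixed_kautz d)" for u v
    using that by (auto simp: arcs_mixed_kautz verts_mixed_kautz kautz_verts_def)
qed

lemma totally_regular_mixed_kautz: "totally_regular 1 z (mixed_kautz (z + 1))"
  unfolding totally_regular_def verts_mixed_kautz
proof (intro ballI conjI)
  fix v assume v: "v \<in> kautz_verts (z + 1)"
  obtain a b where [simp]: "v = (a, b)"
    by (cases v)
  have ab: "a \<le> z + 1" "b \<le> z + 1" "a \<noteq> b"
    using v by (auto simp: kautz_verts_def)
  have card: "card ({..z + 1} - {a, b}) = z"
    using ab by (subst card_Diff_subset) auto
  have "{e \<in> edges (mixed_kautz (z + 1)). v \<in> e} = {{(a, b), (b, a)}}"
    using ab by (auto simp: edges_mixed_kautz kautz_verts_def insert_commute)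
  then show "undirected_degree (mixed_kautz (z + 1)) v = 1"
    by (simp add: undirected_degree_def)
  have "{e \<in> arcs (mixed_kautz (z + 1)). fst e = v} = (\<lambda>c. (v, (b, c))) ` ({..z + 1} - {a, b})"
    using ab by (auto simp: arcs_mixed_kautz kautz_verts_def)
  then show "out_degree (mixed_kautz (z + 1)) v = z"
    using card by (simp add: out_degree_def card_image inj_on_def)
  have "{e \<in> arcs (mixed_kautz (z + 1)). snd e = v} = (\<lambda>c. ((c, a), v)) ` ({..z + 1} - {a, b})"
    using ab by (auto simp: arcs_mixed_kautz kautz_verts_def)
  then show "in_degree (mixed_kautz (z + 1)) v = z"
    using card by (simp add: in_degree_def card_image inj_on_def)
qed

section \<open>The swapped Kautz graph\<close>

context
  fixes z :: nat
  assumes z: "z \<ge> 2"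
begin

interpretation moore_order_graph "swapped_kautz z" z
proof -
  note swappable = swapped_kautz_arc_swappable[OF z]
  show "moore_order_graph (swapped_kautz z) z"
    unfolding swapped_kautz_def moore_order_graph_def moore_order_graph_axioms_def
    using mixed_graph_arc_swap[OF swappable mixed_graph_mixed_kautz]
      totally_regular_arc_swap[OF swappable totally_regular_mixed_kautz]
    by (simp add: arc_swap_def verts_mixed_kautz card_kautz_verts)
qed

lemma verts_swapped_kautz: "verts (swapped_kautz z) = kautz_verts (z + 1)"
  by (simp add: swapped_kautz_def arc_swap_def verts_mixed_kautz)

lemma adjacent_swapped_kautz:
  "adjacent (swapped_kautz z) (a, b) (c, e) \<longleftrightarrow>
    (a, b) \<in> kautz_verts (z + 1) \<and> (c, e) \<in> kautz_verts (z + 1) \<and>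
      c = b \<and> ((a, b), (c, e)) \<notin> {((0, 1), (1, 2)), ((0, 3), (3, 2))} \<or>
    ((a, b), (c, e)) \<in> {((0, 1), (3, 2)), ((0, 3), (1, 2))}"
  unfolding swapped_kautz_def
  by (subst adjacent_arc_swap[OF swapped_kautz_arc_swappable[OF z] mixed_kautz_no_parallel])
    (auto simp: adjacent_mixed_kautz)

text \<open>
  In the Kautz digraph the walk of length \<open>2\<close> from \<open>ab\<close> to \<open>ce\<close> with \<open>b \<noteq> c\<close> is \<open>ab\<close>, \<open>bc\<close>, \<open>ce\<close>.
  If its first arc was removed, then \<open>c = 2\<close>, and the arc added at \<open>ab\<close> leads to the other one of
  \<open>12\<close> and \<open>32\<close>, which is adjacent to \<open>2e\<close> as well. If its second arc was removed, then \<open>b = 0\<close>,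
  and the walk can pass through the other one of \<open>01\<close> and \<open>03\<close>, from which the arc to \<open>ce\<close> was added.
\<close>

lemma distance_swapped_kautz_le_2:
  assumes "v \<in> kautz_verts (z + 1)" "w \<in> kautz_verts (z + 1)"
    and "(v, w) \<noteq> ((0, 1), (1, 2))" "(v, w) \<noteq> ((0, 3), (3, 2))"
  shows "distance (swapped_kautz z) v w \<le> 2"
proof -
  obtain a b c e where [simp]: "v = (a, b)" "w = (c, e)"
    by (cases v; cases w)
  have ne: "a \<noteq> b" "c \<noteq> e" and le: "a \<le> z + 1" "b \<le> z + 1" "c \<le> z + 1" "e \<le> z + 1"
    using assms by (auto simp: kautz_verts_def)
  let ?adj = "adjacent (swapped_kautz z)"
  have "?adj (a, b) (c, e) \<or> (\<exists>x y. ?adj (a, b) (x, y) \<and> ?adj (x, y) (c, e))"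
  proof (cases "b = c")
    case True
    with assms show ?thesis
      by (auto simp: adjacent_swapped_kautz)
  next
    case False
    consider "(a, b) = (0, 1)" "c = 2" | "(a, b) = (0, 3)" "c = 2"
      | "b = 0" "(c, e) = (1, 2)" | "b = 0" "(c, e) = (3, 2)"
      | "((a, b), (b, c)) \<notin> {((0, 1), (1, 2)), ((0, 3), (3, 2))}"
        "((b, c), (c, e)) \<notin> {((0, 1), (1, 2)), ((0, 3), (3, 2))}"
      by (simp only: insert_iff empty_iff prod.inject) blast
    then show ?thesis
    proof cases
      case 1
      then have "?adj (a, b) (3, 2) \<and> ?adj (3, 2) (c, e)"
        using ne le z by (simp add: adjacent_swapped_kautz kautz_verts_def)
      then show ?thesis
        by blast
    next
      case 2
      then have "?adj (a, b) (1, 2) \<and> ?adj (1, 2) (c, e)"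
        using ne le z by (simp add: adjacent_swapped_kautz kautz_verts_def)
      then show ?thesis
        by blast
    next
      case 3
      then have "?adj (a, b) (0, 3) \<and> ?adj (0, 3) (c, e)"
        using ne le z by (simp add: adjacent_swapped_kautz kautz_verts_def)
      then show ?thesis
        by blast
    next
      case 4
      then have "?adj (a, b) (0, 1) \<and> ?adj (0, 1) (c, e)"
        using ne le z by (simp add: adjacent_swapped_kautz kautz_verts_def)
      then show ?thesis
        by blast
    next
      case 5
      then have "?adj (a, b) (b, c) \<and> ?adj (b, c) (c, e)"
        using ne le False by (simp add: adjacent_swapped_kautz kautz_verts_def)
      then show ?thesis
        by blast
    qed
  qed
  then show ?thesis
    using distance_le_2_iff[of v w] assms(1) by (auto simp: verts_swapped_kautz)
qed

lemma distance_swapped_kautz_le_2_iff: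
  assumes "v \<in> kautz_verts (z + 1)" "w \<in> kautz_verts (z + 1)"
  shows "distance (swapped_kautz z) v w \<le> 2 \<longleftrightarrow>
    (v, w) \<noteq> ((0, 1), (1, 2)) \<and> (v, w) \<noteq> ((0, 3), (3, 2))"
proof -
  have "\<not> distance (swapped_kautz z) (0, 1) (1, 2) \<le> 2"
    "\<not> distance (swapped_kautz z) (0, 3) (3, 2) \<le> 2"
    using z by (auto simp: distance_le_2_iff verts_swapped_kautz adjacent_swapped_kautz
        kautz_verts_def)
  then show ?thesis
    using distance_swapped_kautz_le_2[OF assms] by auto
qed

lemma distance_swapped_kautz_le_3:
  assumes "v \<in> kautz_verts (z + 1)" "w \<in> kautz_verts (z + 1)"
  shows "distance (swapped_kautz z) v w \<le> 3"
proof -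
  \<comment> \<open>Each of \<open>01\<close> and \<open>03\<close> gets to its lost head by way of the other, which took that head over.\<close>
  have "path (swapped_kautz z) (0, 1) [(0, 1), (1, 0), (0, 3), (1, 2)] (1, 2)"
    "path (swapped_kautz z) (0, 3) [(0, 3), (3, 0), (0, 1), (3, 2)] (3, 2)"
    using z by (auto simp: path_def walk_def adjacent_swapped_kautz verts_swapped_kautz
        kautz_verts_def)
  then have "distance (swapped_kautz z) (0, 1) (1, 2) \<le> 3"
    "distance (swapped_kautz z) (0, 3) (3, 2) \<le> 3"
    by (auto dest!: distance_le_length simp: numeral_eq_enat eval_nat_numeral)
  moreover have "distance (swapped_kautz z) v w \<le> 3" if "distance (swapped_kautz z) v w \<le> 2"
    using that by (rule order_trans) (simp add: numeral_eq_enat)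
  ultimately show ?thesis
    using distance_swapped_kautz_le_2[OF assms] by auto
qed

lemma radius_swapped_kautz: "radius (swapped_kautz z) = 2"
proof (rule antisym)
  \<comment> \<open>Any vertex other than \<open>01\<close> and \<open>03\<close> is central; \<open>10\<close> is one for all \<open>z\<close>.\<close>
  have "radius (swapped_kautz z) \<le> out_eccentricity (swapped_kautz z) (1, 0)"
    unfolding radius_def
    by (rule INF_lower) (simp add: verts_swapped_kautz kautz_verts_def)
  also have "\<dots> \<le> 2"
    unfolding out_eccentricity_def
    by (rule SUP_least, subst distance_swapped_kautz_le_2_iff)
      (auto simp: verts_swapped_kautz kautz_verts_def)
  finally show "radius (swapped_kautz z) \<le> 2" .
  show "2 \<le> radius (swapped_kautz z)"
    unfolding radius_def using z by (intro INF_greatest out_eccentricity_ge_2) auto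
qed

lemma diameter_swapped_kautz: "diameter (swapped_kautz z) = 3"
proof -
  have "(0, 1) \<in> kautz_verts (z + 1)" "(1, 2) \<in> kautz_verts (z + 1)"
    using z by (auto simp: kautz_verts_def)
  then show ?thesis
    unfolding diameter_3_iff verts_swapped_kautz
    using distance_swapped_kautz_le_2_iff distance_swapped_kautz_le_3 by blast
qed

lemma mixed_radial_moore_graph_swapped_kautz:
  "mixed_radial_moore_graph 1 z 2 (swapped_kautz z)"
  unfolding mixed_radial_moore_graph_iff
  using moore_order_graph_axioms radius_swapped_kautz diameter_swapped_kautz by blast

lemma status_swapped_kautz:
  assumes "v \<in> kautz_verts (z + 1)"
  shows "the_enat (status (swapped_kautz z) v) =
    moore_status 1 z 2 + of_bool (v \<in> {(0, 1), (0, 3)})"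
proof -
  have "{w \<in> kautz_verts (z + 1). \<not> distance (swapped_kautz z) v w \<le> 2} =
      (if v = (0, 1) then {(1, 2)} else if v = (0, 3) then {(3, 2)} else {})"
  proof -
    have "(0, 1) \<in> kautz_verts (z + 1)" "(0, 3) \<in> kautz_verts (z + 1)"
      "(1, 2) \<in> kautz_verts (z + 1)" "(3, 2) \<in> kautz_verts (z + 1)"
      using z by (auto simp: kautz_verts_def)
    then show ?thesis
      using assms by (auto simp: distance_swapped_kautz_le_2_iff split: if_splits)
  qed
  moreover have "{v, w} \<notin> edges (swapped_kautz z)" if "(v, w) \<in> arcs (swapped_kautz z)" for w
    using arc_swap_no_parallel[OF swapped_kautz_arc_swappable[OF z] mixed_kautz_no_parallel] that
    unfolding swapped_kautz_def by blast
  ultimately show ?thesis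
    using status_eq_moore_plus_far[of v] assms distance_swapped_kautz_le_3[OF assms]
    by (simp add: verts_swapped_kautz)
qed

lemma sum_status_deviation_swapped_kautz:
  assumes "1 \<le> p"
  shows "(\<Sum>v\<in>verts (swapped_kautz z).
    \<bar>real (the_enat (status (swapped_kautz z) v)) - real (moore_status 1 z 2)\<bar> ^ p) = 2"
proof -
  have "(\<Sum>v\<in>kautz_verts (z + 1).
      \<bar>real (the_enat (status (swapped_kautz z) v)) - real (moore_status 1 z 2)\<bar> ^ p) =
      (\<Sum>v\<in>kautz_verts (z + 1). of_bool (v \<in> {(0, 1), (0, 3)}))"
    using assms by (intro sum.cong) (auto simp: status_swapped_kautz)
  also have "\<dots> = real (card (kautz_verts (z + 1) \<inter> {(0, 1), (0, 3)}))"
    using finite_kautz_verts by (subst sum_of_bool_eq) (auto simp: Int_def)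
  also have "kautz_verts (z + 1) \<inter> {(0, 1), (0, 3)} = {(0, 1), (0, 3)}"
    using z by (auto simp: kautz_verts_def)
  finally show ?thesis
    by (simp add: verts_swapped_kautz)
qed

lemma status_norm_swapped_kautz_le:
  assumes "mixed_radial_moore_graph 1 z 2 G" "1 \<le> p"
  shows "status_norm 1 z 2 p (swapped_kautz z) \<le> status_norm 1 z 2 p G"
  using assms moore_order_graph.sum_status_deviation_ge_2[of G z p]
  unfolding mixed_radial_moore_graph_iff status_norm_def
  by (simp only: sum_status_deviation_swapped_kautz) (simp add: real_root_le_mono)

end

text \<open>The least \<open>p\<close> for which the norms differ witnesses that \<open>G\<close> is closer.\<close>

lemma closer_to_moore_if_le:
  assumes "\<And>p. 1 \<le> p \<Longrightarrow> status_norm r z k p G \<le> status_norm r z k p H"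
  shows "(\<forall>p\<ge>1. status_norm r z k p G = status_norm r z k p H) \<or> closer_to_moore r z k G H"
proof (rule disjCI)
  let ?differs = "\<lambda>p. 1 \<le> p \<and> status_norm r z k p G \<noteq> status_norm r z k p H"
  assume not_closer: "\<not> closer_to_moore r z k G H"
  show "\<forall>p\<ge>1. status_norm r z k p G = status_norm r z k p H"
  proof (rule ccontr)
    assume "\<not> ?thesis"
    then have "\<exists>l. ?differs l"
      by blast
    then obtain l where l: "?differs l" and before: "\<And>p. p < l \<Longrightarrow> \<not> ?differs p"
      unfolding exists_least_iff[of ?differs] by blast
    have "status_norm r z k l G < status_norm r z k l H"
      using l assms[of l] by simp
    with l before have "closer_to_moore r z k G H"
      unfolding closer_to_moore_def by blast
    with not_closer show False ..
  qed
qed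

theorem corollary4p5:
  fixes z :: nat
  assumes "z \<ge> 2"
  shows "mixed_radial_moore_graph 1 z 2 (swapped_kautz z) \<and>
    (\<forall>G :: 'a mgraph. mixed_radial_moore_graph 1 z 2 G \<longrightarrow>
       (\<forall>p\<ge>1. status_norm 1 z 2 p (swapped_kautz z) = status_norm 1 z 2 p G) \<or>
       closer_to_moore 1 z 2 (swapped_kautz z) G)"
  using mixed_radial_moore_graph_swapped_kautz[OF assms]
    status_norm_swapped_kautz_le[OF assms] closer_to_moore_if_le by blast

end
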